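(* Let $\eta \in (0,1]$. There is a constant $c(\eta) > 0$, depending only on $\eta$, such that the following holds. Let $X = \{x_1, \ldots, x_n\} \subseteq \mathbb{R}^d$ satisfy the $\ell_2^2$ triangle inequalities, i.e. $\|x_i - x_j\|_2^2 + \|x_j - x_k\|_2^2 \geq \|x_i - x_k\|_2^2$ for all $i,j,k \in [n]$, and suppose $\operatorname{ssr}_\eta(X) = r$. Then there is a map $h : X \to \mathbb{R}^{d'}$ (for some $d'$) such that $$\|h(x_i) - h(x_j)\|_1 \leq \|x_i - x_j\|_2^2 \quad \forall i,j \in [n],$$ and $$\sum_{i,j \in [n]} \|h(x_i) - h(x_j)\|_1 \;\geq\; \frac{c(\eta)}{\sqrt{r}} \sum_{i,j\in[n]} \|x_i - x_j\|_2^2 .$$ That is, $X$ embeds contractively into $\ell_1$ with average distortion $O_\eta(\sqrt{r})$.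
   Context: For $\eta \in (0,1]$, a point set $X = \{x_1,\ldots,x_n\} \subseteq \mathbb{R}^d$ has $\eta$-subspace rank $r$, written $\operatorname{ssr}_\eta(X) = r$, if there exists an orthogonal projector $\Pi \in \mathbb{R}^{d\times d}$ of rank $r$ with $\sum_{i,j\in[n]} \|\Pi x_i - \Pi x_j\|_2^2 \geq \eta \sum_{i,j\in[n]} \|x_i - x_j\|_2^2$. *)

theory Defs
  imports Complex_Main "Jordan_Normal_Form.DL_Rank"
begin

text \<open>
  The constant in the theorem must not depend on the dimensions \<open>d\<close>, \<open>d'\<close>, so these are
  numbers rather than types: \<open>\<real>\<^sup>d\<close> is \<^term>\<open>carrier_vec d :: real vec set\<close>.
\<close>

definition l1_norm :: "real vec \<Rightarrow> real" where
  "l1_norm v = (\<Sum>k<dim_vec v. \<bar>v $ k\<bar>)"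

definition l2_norm :: "real vec \<Rightarrow> real" where
  "l2_norm v = sqrt (\<Sum>k<dim_vec v. (v $ k)\<^sup>2)"

definition orthogonal_projector :: "nat \<Rightarrow> real mat \<Rightarrow> bool" where
  "orthogonal_projector d P \<longleftrightarrow>
     P \<in> carrier_mat d d \<and> P * P = P \<and> transpose_mat P = P"

text \<open>
  A point set \<open>{x\<^sub>1, \<dots>, x\<^sub>n} \<subseteq> \<real>\<^sup>d\<close> is given by an enumeration \<open>x\<close> on \<open>{..<n}\<close>, which need not
  be injective. Having \<open>\<eta>\<close>-subspace rank \<open>r\<close> is a relation, not a function of the points:
  any rank \<open>r\<close> admitting a suitable projector qualifies, not only the least one.
\<close>

definition has_ssr :: "real \<Rightarrow> nat \<Rightarrow> nat \<Rightarrow> (nat \<Rightarrow> real vec) \<Rightarrow> nat \<Rightarrow> bool" where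
  "has_ssr \<eta> d n x r \<longleftrightarrow>
     (\<exists>P. orthogonal_projector d P \<and> vec_space.rank d P = r \<and>
        (\<Sum>i<n. \<Sum>j<n. (l2_norm (P *\<^sub>v x i - P *\<^sub>v x j))\<^sup>2)
          \<ge> \<eta> * (\<Sum>i<n. \<Sum>j<n. (l2_norm (x i - x j))\<^sup>2))"

definition l22_triangle :: "nat \<Rightarrow> (nat \<Rightarrow> real vec) \<Rightarrow> bool" where
  "l22_triangle n x \<longleftrightarrow>
     (\<forall>i<n. \<forall>j<n. \<forall>k<n.
        (l2_norm (x i - x j))\<^sup>2 + (l2_norm (x j - x k))\<^sup>2 \<ge> (l2_norm (x i - x k))\<^sup>2)"

end

(*
  By the triangle inequalities, x_k projects orthogonally into the segment from x_i to x_j, so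
  |<x_i - x_j, u>| <= |x_i - x_j|^2 for every difference u = x_k - x_l. Hence the Hilbert norm
  q(z)^2 = sum_u p_u <z, u>^2 with any probability weights p satisfies q(x_i - x_j) <= |x_i - x_j|^2.
  It is realised in l_1 up to a constant by averaging over random signs (Khinchine).

  The weights p_u = |u|^2 / T, where T = sum_u |u|^2, give a large average. With Phi = sum_z q(z) and
  C = sum_z (|z| / sqrt (q z)) z z^T,
    T Phi = sum_{z,u} |u|^2 <z,u>^2 / q(z) >= |C|_F^2 >= tr(P C)^2 / r,
  by AM-GM after symmetrising in z and u and by Cauchy-Schwarz with |P|_F^2 = tr P = r. Hoelder and
  sum_z |P z|^2 >= eta T give tr(P C) >= (eta T)^(3/2) / sqrt Phi, so Phi >= eta^(3/2) T / sqrt r.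
*)
theory Submission
  imports Defs "HOL-Analysis.Convex"
begin

unbundle no inner_syntax

section \<open>Trace and Frobenius norm of projectors\<close>

text \<open>Rank factorisation: if the columns in a maximal independent set \<open>S\<close> form a
  matrix B and the coefficients \<open>c\<close> form C, then P = B C. Idempotence forces C B = I,
  so tr P = tr (C B) = \<open>card S\<close>.\<close>

lemma (in vec_space) idempotent_trace_eq_rank:
  assumes P: "P \<in> carrier_mat n n" and idem: "P * P = P"
  shows "(\<Sum>i<n. P $$ (i, i)) = of_nat (rank P)"
proof -
  obtain S where max: "maximal S (\<lambda>T. T \<subseteq> set (cols P) \<and> lin_indpt T)" and finS: "finite S"
    using maximal_exists_superset[of "set (cols P)" "\<lambda>T. T \<subseteq> set (cols P) \<and> lin_indpt T" "{}"]
      finite_lin_indpt2[of "{}"] by auto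
  have SP: "S \<subseteq> set (cols P)" and indpt: "lin_indpt S"
    using max by (auto simp: maximal_def)
  have colsP: "set (cols P) \<subseteq> carrier_vec n" using P cols_dim by blast
  have S: "S \<subseteq> carrier_vec n" using SP colsP by blast
  have rank: "rank P = card S" by (rule rank_card_indpt[OF P max])
  have "col P j \<in> span S" if "j < n" for j
  proof (cases "col P j \<in> S")
    case True
    then show ?thesis using span_mem[OF S] by blast
  next
    case False
    have mem: "col P j \<in> set (cols P)" using that P by (auto simp: cols_def)
    have "\<not> lin_indpt (S \<union> {col P j})"
    proof
      assume "lin_indpt (S \<union> {col P j})"
      then have "S \<union> {col P j} = S"
        using max SP mem unfolding maximal_def by blast
      then show False using False by blast
    qed
    then show ?thesis using lin_dep_iff_in_span[OF S indpt _ False] mem colsP by blast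
  qed
  then have "\<exists>a. col P j = lincomb a S" if "j < n" for j
    using that finite_span[OF finS S] by auto
  then obtain c where c: "\<And>j. j < n \<Longrightarrow> col P j = lincomb (c j) S" by metis
  have Pij: "P $$ (i, j) = (\<Sum>b\<in>S. c j b * b $ i)" if "i < n" "j < n" for i j
    using c[OF that(2)] lincomb_index[OF that(1) S] that P by (metis index_col carrier_matD)
  \<comment> \<open>Each \<open>b\<close> is a column of \<open>P\<close>, and P P = P says that
    \<open>P\<close> fixes its own columns.\<close>
  have fixS: "b $ i = (\<Sum>j<n. P $$ (i, j) * b $ j)" if b: "b \<in> S" and i: "i < n" for b i
  proof -
    obtain k where k: "k < n" "b = col P k"
      using b SP P by (auto simp: cols_def)
    have "b $ i = (P * P) $$ (i, k)" using idem k i P by simp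
    also have "\<dots> = (\<Sum>j<n. P $$ (i, j) * b $ j)"
      using k i P by (simp add: scalar_prod_def lessThan_atLeast0)
    finally show ?thesis .
  qed
  have coord: "(\<Sum>j<n. c j b' * b $ j) = (if b' = b then 1 else 0)"
    if b: "b \<in> S" and b': "b' \<in> S" for b b'
  proof -
    \<comment> \<open>Writing b = P b through the coefficients \<open>c\<close> gives a second
      expansion of \<open>b\<close> over \<open>S\<close>. \<open>f\<close> is the difference
      between it and the trivial one, so it vanishes by independence.\<close>
    define f where "f b' = (\<Sum>j<n. c j b' * b $ j) - (if b' = b then 1 else 0)" for b'
    have "lincomb f S = 0\<^sub>v n"
    proof (rule eq_vecI)
      fix i assume "i < dim_vec (0\<^sub>v n :: 'a vec)"
      then have i: "i < n" by simp
      have "b $ i = (\<Sum>j<n. (\<Sum>b'\<in>S. c j b' * b' $ i) * b $ j)"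
        using fixS[OF b i] by (simp add: Pij i)
      also have "\<dots> = (\<Sum>b'\<in>S. (\<Sum>j<n. c j b' * b $ j) * b' $ i)"
        unfolding sum_distrib_right by (subst sum.swap) (simp add: mult_ac)
      finally have "(\<Sum>b'\<in>S. (\<Sum>j<n. c j b' * b $ j) * b' $ i) - b $ i = 0" by simp
      moreover have "(\<Sum>b'\<in>S. (if b' = b then 1 else 0) * b' $ i) = b $ i"
        using finS b by (simp add: if_distrib[of "\<lambda>x. x * _"] cong: if_cong)
      ultimately have "(\<Sum>b'\<in>S. f b' * b' $ i) = 0"
        by (simp add: f_def left_diff_distrib sum_subtractf)
      then show "lincomb f S $ i = 0\<^sub>v n $ i"
        using lincomb_index[OF i S] i by simp
    qed (use lincomb_dim[OF finS S] in simp)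
    then have "f \<in> S \<rightarrow> {0}"
      using not_lindepD[OF indpt finS order_refl] by auto
    then have "f b' = 0" using b' by auto
    then show ?thesis by (simp add: f_def)
  qed
  have "(\<Sum>i<n. P $$ (i, i)) = (\<Sum>i<n. \<Sum>b\<in>S. c i b * b $ i)" by (simp add: Pij)
  also have "\<dots> = (\<Sum>b\<in>S. \<Sum>i<n. c i b * b $ i)" by (rule sum.swap)
  also have "\<dots> = of_nat (card S)" by (simp add: coord)
  finally show ?thesis by (simp add: rank)
qed

lemma l2_norm_sq: "(l2_norm v)\<^sup>2 = v \<bullet> v"
  by (simp add: l2_norm_def scalar_prod_def sum_nonneg lessThan_atLeast0)
     (simp add: power2_eq_square)

text \<open>Symmetry turns the sum of squares along a row into a diagonal entry of P P = P, so the
  squared Frobenius norm is the trace.\<close>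

lemma orthogonal_projector_frobenius:
  assumes "orthogonal_projector d P"
  shows "(\<Sum>i<d. \<Sum>j<d. (P $$ (i, j))\<^sup>2) = real (vec_space.rank d P)"
proof -
  have P: "P \<in> carrier_mat d d" and idem: "P * P = P" and sym: "transpose_mat P = P"
    using assms by (auto simp: orthogonal_projector_def)
  have "(\<Sum>j<d. (P $$ (i, j))\<^sup>2) = P $$ (i, i)" if i: "i < d" for i
  proof -
    have "P $$ (i, j) = P $$ (j, i)" if "j < d" for j
      using sym i that P by (metis index_transpose_mat(1) carrier_matD)
    then have "(\<Sum>j<d. (P $$ (i, j))\<^sup>2) = (\<Sum>j<d. P $$ (i, j) * P $$ (j, i))"
      by (simp add: power2_eq_square)
    also have "\<dots> = (P * P) $$ (i, i)"
      using i P by (simp add: scalar_prod_def lessThan_atLeast0)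
    finally show ?thesis by (simp add: idem)
  qed
  then show ?thesis
    using vec_space.idempotent_trace_eq_rank[OF P idem] by simp
qed

lemma orthogonal_projector_norm:
  assumes "orthogonal_projector d P" and v: "v \<in> carrier_vec d"
  shows "(l2_norm (P *\<^sub>v v))\<^sup>2 = v \<bullet> (P *\<^sub>v v)"
proof -
  have P: "P \<in> carrier_mat d d" and idem: "P * P = P" and sym: "transpose_mat P = P"
    using assms by (auto simp: orthogonal_projector_def)
  have Pv: "P *\<^sub>v v \<in> carrier_vec d" using P v by simp
  have "(P *\<^sub>v v) \<bullet> (P *\<^sub>v v) = v \<bullet> (P *\<^sub>v (P *\<^sub>v v))"
    using transpose_vec_mult_scalar[OF P Pv v] sym comm_scalar_prod[OF v] Pv P
    by (metis comm_scalar_prod mult_mat_vec_carrier)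
  also have "P *\<^sub>v (P *\<^sub>v v) = P *\<^sub>v v"
    using assoc_mult_mat_vec[OF P P v] idem by simp
  finally show ?thesis by (simp add: l2_norm_sq)
qed

lemma orthogonal_projector_norm_le:
  assumes "orthogonal_projector d P" and v: "v \<in> carrier_vec d"
  shows "(l2_norm (P *\<^sub>v v))\<^sup>2 \<le> (l2_norm v)\<^sup>2"
proof -
  have Pv: "P *\<^sub>v v \<in> carrier_vec d"
    using assms by (auto simp: orthogonal_projector_def)
  have "0 \<le> (l2_norm (v - P *\<^sub>v v))\<^sup>2" by simp
  also have "\<dots> = v \<bullet> v - 2 * (v \<bullet> (P *\<^sub>v v)) + (P *\<^sub>v v) \<bullet> (P *\<^sub>v v)"
    using v Pv comm_scalar_prod[OF v Pv]
    by (simp add: l2_norm_sq minus_scalar_prod_distrib[of _ d] scalar_prod_minus_distrib[of _ d])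
  finally show ?thesis
    using orthogonal_projector_norm[OF assms] by (simp add: l2_norm_sq)
qed

text \<open>Cauchy-Schwarz for the Frobenius inner product of \<open>P\<close> with C = sum_p c_p
  z_p z_p^T. The sum on the left is tr (P C), the double sum is |C|_F^2, and the rank is
  |P|_F^2.\<close>

lemma orthogonal_projector_weighted_sum:
  assumes P: "orthogonal_projector d P" and z: "\<And>p. p \<in> I \<Longrightarrow> z p \<in> carrier_vec d"
  shows "(\<Sum>p\<in>I. c p * (l2_norm (P *\<^sub>v z p))\<^sup>2)\<^sup>2
    \<le> real (vec_space.rank d P) * (\<Sum>p\<in>I. \<Sum>u\<in>I. c p * c u * (z p \<bullet> z u)\<^sup>2)"
proof -
  let ?D = "{..<d} \<times> {..<d}"
  define C where "C = (\<lambda>(a, b). \<Sum>p\<in>I. c p * (z p $ a * z p $ b))"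
  have Pc: "P \<in> carrier_mat d d" using P by (simp add: orthogonal_projector_def)
  have norm: "(l2_norm (P *\<^sub>v z p))\<^sup>2 = (\<Sum>(a, b)\<in>?D. P $$ (a, b) * (z p $ a * z p $ b))"
    if "p \<in> I" for p
    using orthogonal_projector_norm[OF P z[OF that]] z[OF that] Pc
    by (simp add: scalar_prod_def sum.cartesian_product[symmetric] sum_distrib_left mult_ac
        lessThan_atLeast0)
  have "(\<Sum>p\<in>I. c p * (l2_norm (P *\<^sub>v z p))\<^sup>2)
      = (\<Sum>p\<in>I. \<Sum>ab\<in>?D. c p * (P $$ ab * (z p $ fst ab * z p $ snd ab)))"
    by (simp add: norm sum_distrib_left case_prod_beta)
  also have "\<dots> = (\<Sum>ab\<in>?D. \<Sum>p\<in>I. c p * (P $$ ab * (z p $ fst ab * z p $ snd ab)))"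
    by (rule sum.swap)
  also have "\<dots> = (\<Sum>ab\<in>?D. P $$ ab * C ab)"
    by (simp add: C_def case_prod_beta sum_distrib_left mult_ac)
  finally have "(\<Sum>p\<in>I. c p * (l2_norm (P *\<^sub>v z p))\<^sup>2)\<^sup>2
      \<le> (\<Sum>ab\<in>?D. (P $$ ab)\<^sup>2) * (\<Sum>ab\<in>?D. (C ab)\<^sup>2)"
    by (simp only: Cauchy_Schwarz_ineq_sum)
  also have "(\<Sum>ab\<in>?D. (P $$ ab)\<^sup>2) = real (vec_space.rank d P)"
    using orthogonal_projector_frobenius[OF P] by (simp add: sum.cartesian_product case_prod_beta)
  also have "(\<Sum>ab\<in>?D. (C ab)\<^sup>2) = (\<Sum>ab\<in>?D. \<Sum>p\<in>I. \<Sum>u\<in>I. c p * c u *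
      ((z p $ fst ab * z u $ fst ab) * (z p $ snd ab * z u $ snd ab)))"
    by (simp add: C_def case_prod_beta power2_eq_square sum_product mult_ac)
  also have "\<dots> = (\<Sum>p\<in>I. \<Sum>ab\<in>?D. \<Sum>u\<in>I. c p * c u *
      ((z p $ fst ab * z u $ fst ab) * (z p $ snd ab * z u $ snd ab)))"
    by (rule sum.swap)
  also have "\<dots> = (\<Sum>p\<in>I. \<Sum>u\<in>I. \<Sum>ab\<in>?D. c p * c u *
      ((z p $ fst ab * z u $ fst ab) * (z p $ snd ab * z u $ snd ab)))"
    by (intro sum.cong refl sum.swap)
  \<comment> \<open>The Frobenius inner product of z_p z_p^T and z_u z_u^T is the square of <z_p,
    z_u>.\<close>
  also have "\<dots> = (\<Sum>p\<in>I. \<Sum>u\<in>I. c p * c u * (z p \<bullet> z u)\<^sup>2)"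
  proof (intro sum.cong refl)
    fix p u assume "p \<in> I" "u \<in> I"
    then have "z p \<bullet> z u = (\<Sum>a<d. z p $ a * z u $ a)"
      using z[of u] by (simp add: scalar_prod_def lessThan_atLeast0)
    then have "(z p \<bullet> z u)\<^sup>2
        = (\<Sum>ab\<in>?D. (z p $ fst ab * z u $ fst ab) * (z p $ snd ab * z u $ snd ab))"
      by (simp add: power2_eq_square sum_product sum.cartesian_product case_prod_beta)
    then show "(\<Sum>ab\<in>?D. c p * c u *
        ((z p $ fst ab * z u $ fst ab) * (z p $ snd ab * z u $ snd ab))) = c p * c u * (z p \<bullet> z u)\<^sup>2"
      by (simp add: sum_distrib_left)
  qed
  finally show ?thesis .
qed

section \<open>Random signs: Khinchine's inequality in L1 and the embedding of a Hilbert seminorm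
  into l1\<close>

text \<open>A Rademacher sum: \<open>A\<close> is the set of indices with sign +1, so averaging over
  \<open>Pow F\<close> is taking the expectation over independent uniform signs.\<close>

definition signed_sum :: "('a \<Rightarrow> real) \<Rightarrow> 'a set \<Rightarrow> 'a set \<Rightarrow> real" where
  "signed_sum a F A = (\<Sum>k\<in>F. (if k \<in> A then 1 else - 1) * a k)"

lemma sum_Pow_insert:
  assumes "finite F" "x \<notin> F"
  shows "(\<Sum>A\<in>Pow (insert x F). g A) = (\<Sum>A\<in>Pow F. g A + g (insert x A))"
proof -
  have inj: "inj_on (insert x) (Pow F)" using assms(2) by (auto simp: inj_on_def)
  have "(\<Sum>A\<in>Pow (insert x F). g A) = (\<Sum>A\<in>Pow F. g A) + (\<Sum>A\<in>insert x ` Pow F. g A)"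
    unfolding Pow_insert using assms by (intro sum.union_disjoint) auto
  also have "\<dots> = (\<Sum>A\<in>Pow F. g A + g (insert x A))"
    by (simp add: sum.reindex[OF inj] sum.distrib)
  finally show ?thesis .
qed

lemma signed_sum_insert:
  assumes "finite F" "x \<notin> F" "A \<subseteq> F"
  shows "signed_sum a (insert x F) A = signed_sum a F A - a x"
    and "signed_sum a (insert x F) (insert x A) = signed_sum a F A + a x"
proof -
  have "(\<Sum>k\<in>F. (if k = x \<or> k \<in> A then 1 else - 1) * a k) = signed_sum a F A"
    unfolding signed_sum_def using assms by (intro sum.cong) auto
  then show "signed_sum a (insert x F) (insert x A) = signed_sum a F A + a x"
    using assms by (simp add: signed_sum_def)
  show "signed_sum a (insert x F) A = signed_sum a F A - a x"
    using assms by (auto simp: signed_sum_def)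
qed

lemma signed_sum_second_moment:
  assumes "finite F"
  shows "(\<Sum>A\<in>Pow F. (signed_sum a F A)\<^sup>2) = 2 ^ card F * (\<Sum>k\<in>F. (a k)\<^sup>2)"
  using assms
proof (induction F)
  case empty
  then show ?case by (simp add: signed_sum_def)
next
  case (insert x F)
  have "(\<Sum>A\<in>Pow (insert x F). (signed_sum a (insert x F) A)\<^sup>2)
      = (\<Sum>A\<in>Pow F. 2 * (signed_sum a F A)\<^sup>2 + 2 * (a x)\<^sup>2)"
    unfolding sum_Pow_insert[OF insert.hyps]
    by (intro sum.cong refl)
       (simp add: signed_sum_insert[OF insert.hyps] power2_eq_square algebra_simps)
  also have "\<dots> = 2 ^ card (insert x F) * (\<Sum>k\<in>insert x F. (a k)\<^sup>2)"
    using insert by (simp add: sum.distrib flip: sum_distrib_left) (simp add: card_Pow algebra_simps)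
  finally show ?case .
qed

lemma signed_sum_fourth_moment:
  assumes "finite F"
  shows "(\<Sum>A\<in>Pow F. (signed_sum a F A) ^ 4) \<le> 3 * 2 ^ card F * (\<Sum>k\<in>F. (a k)\<^sup>2)\<^sup>2"
  using assms
proof (induction F)
  case empty
  then show ?case by (simp add: signed_sum_def)
next
  case (insert x F)
  let ?s = "\<Sum>k\<in>F. (a k)\<^sup>2"
  have "(\<Sum>A\<in>Pow (insert x F). (signed_sum a (insert x F) A) ^ 4)
      = (\<Sum>A\<in>Pow F. 2 * (signed_sum a F A) ^ 4 + 12 * (a x)\<^sup>2 * (signed_sum a F A)\<^sup>2 + 2 * (a x) ^ 4)"
    unfolding sum_Pow_insert[OF insert.hyps]
    by (intro sum.cong refl)
       (simp add: signed_sum_insert[OF insert.hyps] power2_eq_square power4_eq_xxxx algebra_simps)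
  also have "\<dots> = 2 * (\<Sum>A\<in>Pow F. (signed_sum a F A) ^ 4)
      + 12 * (a x)\<^sup>2 * (2 ^ card F * ?s) + 2 ^ card F * (2 * (a x) ^ 4)"
    using insert.hyps
    by (simp add: sum.distrib card_Pow signed_sum_second_moment flip: sum_distrib_left)
  \<comment> \<open>Raising the coefficient of \<open>(a x) ^ 4\<close> from 2 to 6 completes the
    square: the bound becomes a multiple of \<open>(?s + (a x)\<^sup>2)\<^sup>2\<close>.\<close>
  also have "\<dots> \<le> 2 * (3 * 2 ^ card F * ?s\<^sup>2)
      + 12 * (a x)\<^sup>2 * (2 ^ card F * ?s) + 2 ^ card F * (6 * (a x) ^ 4)"
    using insert.IH by (intro add_mono mult_left_mono) auto
  also have "\<dots> = 3 * 2 ^ card (insert x F) * (\<Sum>k\<in>insert x F. (a k)\<^sup>2)\<^sup>2"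
    using insert.hyps by (simp add: power2_eq_square power4_eq_xxxx algebra_simps)
  finally show ?case .
qed

lemma signed_sum_abs_upper:
  assumes "finite F"
  shows "(\<Sum>A\<in>Pow F. \<bar>signed_sum a F A\<bar>) \<le> 2 ^ card F * sqrt (\<Sum>k\<in>F. (a k)\<^sup>2)"
proof (rule power2_le_imp_le)
  have "(\<Sum>A\<in>Pow F. 1 * \<bar>signed_sum a F A\<bar>)\<^sup>2
      \<le> (\<Sum>A\<in>Pow F. 1\<^sup>2) * (\<Sum>A\<in>Pow F. \<bar>signed_sum a F A\<bar>\<^sup>2)"
    by (rule Cauchy_Schwarz_ineq_sum)
  also have "\<dots> = (2 ^ card F * sqrt (\<Sum>k\<in>F. (a k)\<^sup>2))\<^sup>2"
    using assms
    by (simp add: signed_sum_second_moment card_Pow power_mult_distrib sum_nonneg)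
       (simp add: power2_eq_square)
  finally show "(\<Sum>A\<in>Pow F. \<bar>signed_sum a F A\<bar>)\<^sup>2 \<le> (2 ^ card F * sqrt (\<Sum>k\<in>F. (a k)\<^sup>2))\<^sup>2"
    by simp
qed (simp add: sum_nonneg)

text \<open>A minorant of the absolute value whose mean involves only the second and fourth moments.
  It touches the graph at |t| = 3 s / 2.\<close>

lemma abs_ge_quartic:
  fixes s t :: real
  assumes "0 < s"
  shows "t\<^sup>2 / s - 4 / 27 * (t ^ 4 / s ^ 3) \<le> \<bar>t\<bar>"
proof -
  define y where "y = \<bar>t\<bar> / s"
  have y: "0 \<le> y" and t: "\<bar>t\<bar> = s * y" using assms by (auto simp: y_def)
  \<comment> \<open>The gap between y and its minorant, times 27/4, factors with a double root at
    the contact point.\<close>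
  have "0 \<le> y * ((y - 3 / 2)\<^sup>2 * (y + 3))" using y by simp
  also have "\<dots> = 27 / 4 * (y - y\<^sup>2 + 4 / 27 * y ^ 4)"
    by (simp add: power2_eq_square power4_eq_xxxx algebra_simps)
  finally have "s * (y\<^sup>2 - 4 / 27 * y ^ 4) \<le> s * y"
    using assms by (intro mult_left_mono) auto
  also have "s * (y\<^sup>2 - 4 / 27 * y ^ 4) = \<bar>t\<bar>\<^sup>2 / s - 4 / 27 * (\<bar>t\<bar> ^ 4 / s ^ 3)"
    unfolding t using assms
    by (simp add: field_simps power2_eq_square power4_eq_xxxx power3_eq_cube)
  finally show ?thesis unfolding t[symmetric] by simp
qed

text \<open>The lower half of Khinchine's inequality: average the quartic minorant, with
  \<open>s\<close> the root mean square, and insert the two moments.\<close>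

lemma signed_sum_abs_lower:
  assumes "finite F"
  shows "2 ^ card F * sqrt (\<Sum>k\<in>F. (a k)\<^sup>2) / 2 \<le> (\<Sum>A\<in>Pow F. \<bar>signed_sum a F A\<bar>)"
proof (cases "(\<Sum>k\<in>F. (a k)\<^sup>2) = 0")
  case True
  then show ?thesis by (simp add: sum_nonneg)
next
  case False
  define s where "s = sqrt (\<Sum>k\<in>F. (a k)\<^sup>2)"
  have s2: "(\<Sum>k\<in>F. (a k)\<^sup>2) = s\<^sup>2" by (simp add: s_def sum_nonneg)
  have s: "0 < s" using False s2 by (metis s_def real_sqrt_ge_zero sum_nonneg zero_le_power2
      less_eq_real_def power_zero_numeral)
  \<comment> \<open>The moments give the factor 1 - 3 * 4/27 = 5/9, rounded down to 1/2.\<close>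
  have "2 ^ card F * s / 2 \<le> 2 ^ card F * s * (5 / 9)" using s by simp
  also have "\<dots> = (2 ^ card F * s\<^sup>2) / s - 4 / 27 * ((3 * 2 ^ card F * (s\<^sup>2)\<^sup>2) / s ^ 3)"
    using s by (simp add: field_simps power2_eq_square power3_eq_cube)
  also have "\<dots> \<le> (\<Sum>A\<in>Pow F. (signed_sum a F A)\<^sup>2) / s
      - 4 / 27 * ((\<Sum>A\<in>Pow F. (signed_sum a F A) ^ 4) / s ^ 3)"
    using signed_sum_second_moment[OF assms, of a] signed_sum_fourth_moment[OF assms, of a] s
    by (intro diff_mono mult_left_mono divide_right_mono) (auto simp: s2)
  also have "\<dots> = (\<Sum>A\<in>Pow F. (signed_sum a F A)\<^sup>2 / s - 4 / 27 * ((signed_sum a F A) ^ 4 / s ^ 3))"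
    by (simp add: sum_subtractf sum_divide_distrib sum_distrib_left)
  also have "\<dots> \<le> (\<Sum>A\<in>Pow F. \<bar>signed_sum a F A\<bar>)"
    by (intro sum_mono abs_ge_quartic s)
  finally show ?thesis by (simp add: s_def)
qed

text \<open>Each sign pattern supplies one coordinate, the signed sum of the
  \<open>s u * (v \<bullet> z u)\<close>. It is linear in \<open>v\<close>, so the l1 distance is
  the mean absolute value of a Rademacher sum. The upper bound has constant 1, which later gives
  contraction; only the lower bound loses a factor 2.\<close>

lemma l2_to_l1_embedding:
  assumes F: "finite F" and z: "\<And>u. u \<in> F \<Longrightarrow> z u \<in> carrier_vec d"
  obtains d' :: nat and h :: "real vec \<Rightarrow> real vec" where
    "\<And>v. h v \<in> carrier_vec d'"
    "\<And>v w. v \<in> carrier_vec d \<Longrightarrow> w \<in> carrier_vec d \<Longrightarrow>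
      l1_norm (h v - h w) \<le> sqrt (\<Sum>u\<in>F. (s u * ((v - w) \<bullet> z u))\<^sup>2)"
    "\<And>v w. v \<in> carrier_vec d \<Longrightarrow> w \<in> carrier_vec d \<Longrightarrow>
      sqrt (\<Sum>u\<in>F. (s u * ((v - w) \<bullet> z u))\<^sup>2) / 2 \<le> l1_norm (h v - h w)"
proof -
  let ?m = "card (Pow F)"
  have m: "real ?m = 2 ^ card F" using F by (simp add: card_Pow)
  obtain e where e: "bij_betw e {..<?m} (Pow F)"
    using ex_bij_betw_nat_finite[of "Pow F"] F by (auto simp: lessThan_atLeast0)
  define h where "h v = vec ?m (\<lambda>k. signed_sum (\<lambda>u. s u * (v \<bullet> z u)) F (e k) / 2 ^ card F)" for v
  have l1: "l1_norm (h v - h w)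
      = (\<Sum>A\<in>Pow F. \<bar>signed_sum (\<lambda>u. s u * ((v - w) \<bullet> z u)) F A\<bar>) / 2 ^ card F"
    if v: "v \<in> carrier_vec d" and w: "w \<in> carrier_vec d" for v w
  proof -
    have lin: "signed_sum (\<lambda>u. s u * (v \<bullet> z u)) F A - signed_sum (\<lambda>u. s u * (w \<bullet> z u)) F A
        = signed_sum (\<lambda>u. s u * ((v - w) \<bullet> z u)) F A" for A
      unfolding signed_sum_def sum_subtractf[symmetric] right_diff_distrib[symmetric]
      by (intro sum.cong refl) (simp add: minus_scalar_prod_distrib[OF v w z])
    have "l1_norm (h v - h w)
        = (\<Sum>k<?m. \<bar>signed_sum (\<lambda>u. s u * ((v - w) \<bullet> z u)) F (e k)\<bar> / 2 ^ card F)"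
      by (simp add: l1_norm_def h_def lin flip: diff_divide_distrib)
    also have "\<dots> = (\<Sum>A\<in>Pow F. \<bar>signed_sum (\<lambda>u. s u * ((v - w) \<bullet> z u)) F A\<bar> / 2 ^ card F)"
      by (rule sum.reindex_bij_betw[OF e])
    finally show ?thesis by (simp add: sum_divide_distrib)
  qed
  show ?thesis
  proof (rule that[of h ?m])
    show "h v \<in> carrier_vec ?m" for v by (simp add: h_def)
    show "l1_norm (h v - h w) \<le> sqrt (\<Sum>u\<in>F. (s u * ((v - w) \<bullet> z u))\<^sup>2)"
      if "v \<in> carrier_vec d" "w \<in> carrier_vec d" for v w
      using signed_sum_abs_upper[OF F, of "\<lambda>u. s u * ((v - w) \<bullet> z u)"]
      by (simp add: l1[OF that] field_simps)
    show "sqrt (\<Sum>u\<in>F. (s u * ((v - w) \<bullet> z u))\<^sup>2) / 2 \<le> l1_norm (h v - h w)"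
      if "v \<in> carrier_vec d" "w \<in> carrier_vec d" for v w
      using signed_sum_abs_lower[OF F, of "\<lambda>u. s u * ((v - w) \<bullet> z u)"]
      by (simp add: l1[OF that] field_simps)
  qed
qed

section \<open>Hoelder and AM-GM estimates for weights sqrt (N / q)\<close>

text \<open>Jensen for t^(-1/2) at the points q/N with weights \<open>v\<close>, followed by v q / N
  \<le> q. The second condition on \<open>q\<close> ensures that a zero denominator
  \<open>q p\<close> occurs only where \<open>v p\<close> = 0.\<close>

lemma sum_root_ratio_ge:
  fixes v N q :: "'a \<Rightarrow> real"
  assumes v: "\<And>p. p \<in> I \<Longrightarrow> 0 \<le> v p \<and> v p \<le> N p"
    and q: "\<And>p. p \<in> I \<Longrightarrow> 0 \<le> q p" "\<And>p. p \<in> I \<Longrightarrow> 0 < N p \<Longrightarrow> 0 < q p"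
  shows "(\<Sum>p\<in>I. v p) ^ 3 \<le> (\<Sum>p\<in>I. sqrt (N p / q p) * v p)\<^sup>2 * (\<Sum>p\<in>I. q p)"
proof (cases "(\<Sum>p\<in>I. v p) = 0")
  case True
  then show ?thesis using q by (simp add: sum_nonneg)
next
  case False
  define M where "M = (\<Sum>p\<in>I. v p)"
  define S where "S = (\<Sum>p\<in>I. q p)"
  have "0 \<le> M" using v by (auto simp: M_def intro: sum_nonneg)
  then have M: "0 < M" using False by (simp add: M_def)
  have fin: "finite I" using False by (metis sum.infinite)
  obtain p where p: "p \<in> I" "v p \<noteq> 0" using False by (meson sum.neutral)
  then have "0 < q p" using v[of p] q by force
  then have S: "0 < S" unfolding S_def using p fin q by (intro sum_pos2[of _ p]) auto
  \<comment> \<open>This \<open>l\<close> maximises \<open>3 / 2 * l * M - l ^ 3 / 2 * S\<close>,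
    the sum of the tangent bounds below, with maximum \<open>l * M\<close>.\<close>
  define l where "l = sqrt (M / S)"
  have l: "0 < l" and l2: "l\<^sup>2 = M / S" using M S by (auto simp: l_def)
  have "3 / 2 * l * v p - l ^ 3 / 2 * q p \<le> sqrt (N p / q p) * v p" if p: "p \<in> I" for p
  proof (cases "N p = 0")
    case True
    then show ?thesis using v[OF p] q(1)[OF p] l by auto
  next
    case False
    then have N: "0 < N p" using v[OF p] by auto
    have qp: "0 < q p" using q(2) p N by simp
    define w where "w = sqrt (N p / q p)"
    have w: "0 < w" and w2: "w\<^sup>2 * q p = N p" using N qp by (auto simp: w_def)
    \<comment> \<open>The tangent of \<open>t \<mapsto> t\<^sup>-\<^sup>1\<^sup>/\<^sup>2\<close> at \<open>l\<^sup>-\<^sup>2\<close> lies below the graph at \<open>t = w\<^sup>-\<^sup>2\<close>.\<close>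
    have "0 \<le> (w - l)\<^sup>2 * (2 * w + l)" using w l by simp
    then have "(3 / 2 * l - w) * w\<^sup>2 \<le> l ^ 3 / 2"
      by (simp add: power2_eq_square power3_eq_cube algebra_simps)
    then have "(3 / 2 * l - w) * w\<^sup>2 * q p \<le> l ^ 3 / 2 * q p"
      using qp by (intro mult_right_mono) auto
    then have *: "(3 / 2 * l - w) * N p \<le> l ^ 3 / 2 * q p" by (simp add: w2 mult.assoc)
    have "(3 / 2 * l - w) * v p \<le> l ^ 3 / 2 * q p"
    \<comment> \<open>\<open>N p\<close> may be lowered to \<open>v p\<close> only under a
      nonnegative factor; otherwise the two sides have opposite signs.\<close>
    proof (cases "3 / 2 * l - w \<ge> 0")
      case True
      then show ?thesis using * v[OF p] by (meson mult_left_mono order_trans)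
    next
      case False
      then have "(3 / 2 * l - w) * v p \<le> 0" using v[OF p] by (intro mult_nonpos_nonneg) auto
      also have "0 \<le> l ^ 3 / 2 * q p" using l qp by simp
      finally show ?thesis .
    qed
    then show ?thesis by (simp add: w_def algebra_simps)
  qed
  then have "(\<Sum>p\<in>I. 3 / 2 * l * v p - l ^ 3 / 2 * q p) \<le> (\<Sum>p\<in>I. sqrt (N p / q p) * v p)"
    by (rule sum_mono)
  moreover have "(\<Sum>p\<in>I. 3 / 2 * l * v p - l ^ 3 / 2 * q p) = 3 / 2 * l * M - l ^ 3 / 2 * S"
    by (simp add: M_def S_def sum_subtractf sum_distrib_left)
  moreover have "l ^ 3 * S = l * M" using l2 S by (simp add: power3_eq_cube power2_eq_square)
  ultimately have "l * M \<le> (\<Sum>p\<in>I. sqrt (N p / q p) * v p)" by argo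
  then have "(l * M)\<^sup>2 \<le> (\<Sum>p\<in>I. sqrt (N p / q p) * v p)\<^sup>2"
    using l M by (intro power_mono) auto
  then have "(l * M)\<^sup>2 * S \<le> (\<Sum>p\<in>I. sqrt (N p / q p) * v p)\<^sup>2 * S"
    using S by (intro mult_right_mono) auto
  moreover have "(l * M)\<^sup>2 * S = M ^ 3"
    using S by (simp add: power_mult_distrib l2) (simp add: power2_eq_square power3_eq_cube)
  ultimately show ?thesis by (simp add: M_def S_def)
qed

text \<open>AM-GM after pairing \<open>N u\<close> with \<open>q p\<close> and \<open>N p\<close>
  with \<open>q u\<close>. By symmetry of \<open>G\<close> both halves have the same sum, and
  \<open>qT\<close> divided by \<open>q p\<close> evaluates it.\<close>

lemma symmetrized_gram_bound:
  fixes N q :: "'a \<Rightarrow> real" and G :: "'a \<Rightarrow> 'a \<Rightarrow> real"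
  assumes N: "\<And>p. p \<in> I \<Longrightarrow> 0 \<le> N p" and q: "\<And>p. p \<in> I \<Longrightarrow> 0 \<le> q p"
    and sym: "\<And>p u. p \<in> I \<Longrightarrow> u \<in> I \<Longrightarrow> G p u = G u p"
    and qT: "\<And>p. p \<in> I \<Longrightarrow> (q p)\<^sup>2 * T = (\<Sum>u\<in>I. N u * (G p u)\<^sup>2)"
  shows "(\<Sum>p\<in>I. \<Sum>u\<in>I. sqrt (N p / q p) * sqrt (N u / q u) * (G p u)\<^sup>2) \<le> T * (\<Sum>p\<in>I. q p)"
proof -
  let ?S = "\<Sum>p\<in>I. \<Sum>u\<in>I. N u / q p * (G p u)\<^sup>2"
  \<comment> \<open>For \<open>q p\<close> = 0 both sides vanish, as division by zero yields
    0.\<close>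
  have "q p * T = (\<Sum>u\<in>I. N u / q p * (G p u)\<^sup>2)" if "p \<in> I" for p
  proof (cases "q p = 0")
    case False
    then show ?thesis using qT[OF that]
      by (simp add: power2_eq_square field_simps flip: sum_divide_distrib)
  qed simp
  then have S: "?S = T * (\<Sum>p\<in>I. q p)" by (simp add: sum_distrib_left mult.commute)
  have swap: "?S = (\<Sum>p\<in>I. \<Sum>u\<in>I. N p / q u * (G p u)\<^sup>2)"
    by (subst sum.swap) (simp add: sym cong: sum.cong)
  have "(\<Sum>p\<in>I. \<Sum>u\<in>I. sqrt (N p / q p) * sqrt (N u / q u) * (G p u)\<^sup>2)
      \<le> (\<Sum>p\<in>I. \<Sum>u\<in>I. (N u / q p + N p / q u) / 2 * (G p u)\<^sup>2)"
  proof (intro sum_mono mult_right_mono)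
    fix p u assume pu: "p \<in> I" "u \<in> I"
    have "sqrt (N p / q p) * sqrt (N u / q u) = sqrt (N u / q p * (N p / q u))"
      by (simp add: real_sqrt_mult[symmetric] mult_ac)
    also have "\<dots> \<le> (N u / q p + N p / q u) / 2"
      using N q pu by (intro arith_geo_mean_sqrt) auto
    finally show "sqrt (N p / q p) * sqrt (N u / q u) \<le> (N u / q p + N p / q u) / 2" .
  qed simp
  also have "\<dots> = (?S + (\<Sum>p\<in>I. \<Sum>u\<in>I. N p / q u * (G p u)\<^sup>2)) / 2"
    unfolding sum.distrib[symmetric] sum_divide_distrib
    by (intro sum.cong refl) (simp add: distrib_right)
  also have "\<dots> = T * (\<Sum>p\<in>I. q p)" unfolding swap[symmetric] S by simp
  finally show ?thesis .
qed

section \<open>From squared-distance triangle inequalities to the l1 embedding\<close>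

text \<open>With D the squared distance, twice the inner product is (D(k,j) - D(k,i)) + (D(l,i) -
  D(l,j)). The triangle inequalities bound each bracket by D(i,j) in absolute value.\<close>

lemma l22_triangle_scalar_prod_le:
  assumes x: "\<And>i. i < n \<Longrightarrow> x i \<in> carrier_vec d" and tri: "l22_triangle n x"
    and ijkl: "i < n" "j < n" "k < n" "l < n"
  shows "\<bar>(x i - x j) \<bullet> (x k - x l)\<bar> \<le> (l2_norm (x i - x j))\<^sup>2"
proof -
  have D: "(l2_norm (x a - x b))\<^sup>2 = x a \<bullet> x a - 2 * (x a \<bullet> x b) + x b \<bullet> x b"
    if "a < n" "b < n" for a b
    using that x[of a] x[of b] comm_scalar_prod[of "x a" d "x b"]
    by (simp add: l2_norm_sq minus_scalar_prod_distrib[of _ d] scalar_prod_minus_distrib[of _ d])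
  have T: "(l2_norm (x a - x c))\<^sup>2 \<le> (l2_norm (x a - x b))\<^sup>2 + (l2_norm (x b - x c))\<^sup>2"
    if "a < n" "b < n" "c < n" for a b c
    using tri that by (simp add: l22_triangle_def)
  have "(x i - x j) \<bullet> (x k - x l) = x i \<bullet> x k - x i \<bullet> x l - x j \<bullet> x k + x j \<bullet> x l"
    using ijkl x[of i] x[of j] x[of k] x[of l]
    by (simp add: minus_scalar_prod_distrib[of _ d] scalar_prod_minus_distrib[of _ d])
  then show ?thesis
    using T[of k j i] T[of k i j] T[of l j i] T[of l i j] ijkl
      comm_scalar_prod[OF x[OF ijkl(1)] x[OF ijkl(2)]]
      comm_scalar_prod[OF x[OF ijkl(3)] x[OF ijkl(1)]]
      comm_scalar_prod[OF x[OF ijkl(3)] x[OF ijkl(2)]]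
      comm_scalar_prod[OF x[OF ijkl(4)] x[OF ijkl(1)]]
      comm_scalar_prod[OF x[OF ijkl(4)] x[OF ijkl(2)]]
    by (simp add: D abs_le_iff)
qed

text \<open>The lower bound on the total of the norms q, for an arbitrary finite family of vectors.
  The preceding estimates are chained with coefficients sqrt (N / q).\<close>

lemma sum_root_quadratic_form_ge:
  assumes I: "finite I" and z: "\<And>p. p \<in> I \<Longrightarrow> z p \<in> carrier_vec d"
    and P: "orthogonal_projector d P" and eta: "0 < \<eta>"
    and T: "T = (\<Sum>p\<in>I. (l2_norm (z p))\<^sup>2)" "0 < T"
    and M: "\<eta> * T \<le> (\<Sum>p\<in>I. (l2_norm (P *\<^sub>v z p))\<^sup>2)"
  shows "sqrt (\<eta> ^ 3) * T \<le> sqrt (vec_space.rank d P)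
    * (\<Sum>p\<in>I. sqrt (\<Sum>u\<in>I. (l2_norm (z u))\<^sup>2 / T * (z p \<bullet> z u)\<^sup>2))"
proof -
  define N where "N p = (l2_norm (z p))\<^sup>2" for p
  define v where "v p = (l2_norm (P *\<^sub>v z p))\<^sup>2" for p
  define q where "q p = sqrt (\<Sum>u\<in>I. N u / T * (z p \<bullet> z u)\<^sup>2)" for p
  define \<Phi> where "\<Phi> = (\<Sum>p\<in>I. q p)"
  let ?r = "real (vec_space.rank d P)"
  have q2: "(q p)\<^sup>2 = (\<Sum>u\<in>I. N u / T * (z p \<bullet> z u)\<^sup>2)" for p
    using T(2) by (simp add: q_def sum_nonneg N_def)
  have q0: "0 \<le> q p" for p using T(2) by (simp add: q_def sum_nonneg N_def)
  have qpos: "0 < q p" if "p \<in> I" "0 < N p" for p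
  proof -
    \<comment> \<open>The term u = p alone is \<open>N p ^ 3 / T\<close>, which is positive.\<close>
    have "0 < (\<Sum>u\<in>I. N u / T * (z p \<bullet> z u)\<^sup>2)"
      using that T(2) I by (intro sum_pos2[of _ p]) (auto simp: N_def l2_norm_sq[symmetric])
    then show ?thesis by (simp add: q_def)
  qed
  have "(\<eta> * T) ^ 3 \<le> (\<Sum>p\<in>I. v p) ^ 3"
    using M eta T(2) by (intro power_mono) (auto simp: v_def)
  also have "\<dots> \<le> (\<Sum>p\<in>I. sqrt (N p / q p) * v p)\<^sup>2 * \<Phi>"
    unfolding \<Phi>_def using orthogonal_projector_norm_le[OF P z] q0 qpos
    by (intro sum_root_ratio_ge) (auto simp: v_def N_def)
  also have "\<dots> \<le> (?r * (\<Sum>p\<in>I. \<Sum>u\<in>I. sqrt (N p / q p) * sqrt (N u / q u) * (z p \<bullet> z u)\<^sup>2)) * \<Phi>"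
    unfolding v_def
    by (intro mult_right_mono orthogonal_projector_weighted_sum[OF P z])
       (auto simp: \<Phi>_def q0 sum_nonneg)
  also have "\<dots> \<le> (?r * (T * \<Phi>)) * \<Phi>"
    unfolding \<Phi>_def
    by (intro mult_right_mono mult_left_mono symmetrized_gram_bound)
       (use comm_scalar_prod[OF z z] q0 T(2) in \<open>auto simp: N_def q2 sum_distrib_right intro: sum_nonneg\<close>)
  \<comment> \<open>One factor \<open>\<Phi>\<close> comes from the Hoelder step and one from the
    Gram bound; hence the square root of the rank after taking roots.\<close>
  finally have "T * (\<eta> ^ 3 * T\<^sup>2) \<le> T * (?r * \<Phi>\<^sup>2)"
    by (simp add: power_mult_distrib power2_eq_square power3_eq_cube mult_ac)
  then have "\<eta> ^ 3 * T\<^sup>2 \<le> ?r * \<Phi>\<^sup>2" using T(2) by simp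
  then have "sqrt (\<eta> ^ 3 * T\<^sup>2) \<le> sqrt (?r * \<Phi>\<^sup>2)" by (rule real_sqrt_le_mono)
  then have "sqrt (\<eta> ^ 3) * T \<le> sqrt ?r * \<Phi>"
    using T(2) q0 by (simp add: real_sqrt_mult \<Phi>_def sum_nonneg)
  then show ?thesis by (simp add: \<Phi>_def q_def N_def)
qed

lemma l22_triangle_l1_embedding:
  assumes eta: "0 < \<eta>" and x: "\<And>i. i < n \<Longrightarrow> x i \<in> carrier_vec d"
    and tri: "l22_triangle n x" and ssr: "has_ssr \<eta> d n x r"
    and T0: "(\<Sum>i<n. \<Sum>j<n. (l2_norm (x i - x j))\<^sup>2) > 0" and r: "0 < r"
  obtains d' :: nat and h :: "real vec \<Rightarrow> real vec" where
    "\<And>v. h v \<in> carrier_vec d'"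
    "\<And>i j. i < n \<Longrightarrow> j < n \<Longrightarrow> l1_norm (h (x i) - h (x j)) \<le> (l2_norm (x i - x j))\<^sup>2"
    "sqrt (\<eta> ^ 3) / 2 / sqrt (real r) * (\<Sum>i<n. \<Sum>j<n. (l2_norm (x i - x j))\<^sup>2)
      \<le> (\<Sum>i<n. \<Sum>j<n. l1_norm (h (x i) - h (x j)))"
proof -
  let ?I = "{..<n} \<times> {..<n}"
  define z where "z = (\<lambda>(i, j). x i - x j)"
  define T where "T = (\<Sum>p\<in>?I. (l2_norm (z p))\<^sup>2)"
  \<comment> \<open>Square roots of probability weights on the ordered differences: with these
    factors the Hilbert seminorm in the embedding lemma is exactly \<open>q\<close>.\<close>
  define s where "s u = sqrt ((l2_norm (z u))\<^sup>2 / T)" for u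
  obtain P where P: "orthogonal_projector d P" and rank: "vec_space.rank d P = r"
    and eT: "(\<Sum>i<n. \<Sum>j<n. (l2_norm (P *\<^sub>v x i - P *\<^sub>v x j))\<^sup>2)
      \<ge> \<eta> * (\<Sum>i<n. \<Sum>j<n. (l2_norm (x i - x j))\<^sup>2)"
    using ssr by (auto simp: has_ssr_def)
  have z: "z p \<in> carrier_vec d" if "p \<in> ?I" for p
    using that x by (auto simp: z_def)
  have T_eq: "T = (\<Sum>i<n. \<Sum>j<n. (l2_norm (x i - x j))\<^sup>2)"
    by (simp add: T_def z_def sum.cartesian_product case_prod_beta)
  have T: "0 < T" using T0 by (simp add: T_eq)
  have Pz: "P *\<^sub>v z (i, j) = P *\<^sub>v x i - P *\<^sub>v x j" if "i < n" "j < n" for i j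
    using P mult_minus_distrib_mat_vec[of P d d "x i" "x j"] x that
    by (simp add: z_def orthogonal_projector_def)
  have "\<eta> * T \<le> (\<Sum>i<n. \<Sum>j<n. (l2_norm (P *\<^sub>v z (i, j)))\<^sup>2)"
    using eT by (simp add: Pz T_eq)
  then have M: "\<eta> * T \<le> (\<Sum>p\<in>?I. (l2_norm (P *\<^sub>v z p))\<^sup>2)"
    by (simp add: sum.cartesian_product case_prod_beta)
  define q where "q p = sqrt (\<Sum>u\<in>?I. (l2_norm (z u))\<^sup>2 / T * (z p \<bullet> z u)\<^sup>2)" for p
  have q_eq: "q p = sqrt (\<Sum>u\<in>?I. (s u * (z p \<bullet> z u))\<^sup>2)" for p
    using T by (simp add: q_def s_def power_mult_distrib)
  have Phi: "sqrt (\<eta> ^ 3) * T \<le> sqrt (real r) * (\<Sum>p\<in>?I. q p)"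
    using sum_root_quadratic_form_ge[OF _ z P eta T_def T M] by (simp add: q_def rank)
  have q_le: "q (i, j) \<le> (l2_norm (x i - x j))\<^sup>2" if ij: "i < n" "j < n" for i j
  proof -
    have "(\<Sum>u\<in>?I. (l2_norm (z u))\<^sup>2 / T * (z (i, j) \<bullet> z u)\<^sup>2)
        \<le> (\<Sum>u\<in>?I. (l2_norm (z u))\<^sup>2 / T * ((l2_norm (x i - x j))\<^sup>2)\<^sup>2)"
    proof (intro sum_mono mult_left_mono)
      fix u assume "u \<in> ?I"
      then have "\<bar>z (i, j) \<bullet> z u\<bar> \<le> (l2_norm (x i - x j))\<^sup>2"
        using l22_triangle_scalar_prod_le[OF x tri ij] by (auto simp: z_def)
      then show "(z (i, j) \<bullet> z u)\<^sup>2 \<le> ((l2_norm (x i - x j))\<^sup>2)\<^sup>2"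
        by (metis abs_ge_zero power2_abs power_mono)
    qed (use T in simp)
    \<comment> \<open>The weights sum to 1, so the uniform bound on the inner products passes to
      their quadratic mean.\<close>
    also have "\<dots> = ((l2_norm (x i - x j))\<^sup>2)\<^sup>2"
      using T by (simp add: T_def[symmetric] flip: sum_distrib_right sum_divide_distrib)
    finally have "q (i, j) \<le> sqrt (((l2_norm (x i - x j))\<^sup>2)\<^sup>2)"
      unfolding q_def by (rule real_sqrt_le_mono)
    then show ?thesis by (simp only: real_sqrt_abs abs_power2)
  qed
  show ?thesis
  proof (rule l2_to_l1_embedding[of ?I z d s])
    fix h :: "real vec \<Rightarrow> real vec" and d' :: nat
    assume h: "\<And>v. h v \<in> carrier_vec d'"
      and upper: "\<And>v w. v \<in> carrier_vec d \<Longrightarrow> w \<in> carrier_vec d \<Longrightarrow>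
        l1_norm (h v - h w) \<le> sqrt (\<Sum>u\<in>?I. (s u * ((v - w) \<bullet> z u))\<^sup>2)"
      and lower: "\<And>v w. v \<in> carrier_vec d \<Longrightarrow> w \<in> carrier_vec d \<Longrightarrow>
        sqrt (\<Sum>u\<in>?I. (s u * ((v - w) \<bullet> z u))\<^sup>2) / 2 \<le> l1_norm (h v - h w)"
    have up: "l1_norm (h (x i) - h (x j)) \<le> q (i, j)"
      and lo: "q (i, j) / 2 \<le> l1_norm (h (x i) - h (x j))" if "i < n" "j < n" for i j
      using upper[OF x[OF that(1)] x[OF that(2)]] lower[OF x[OF that(1)] x[OF that(2)]]
      by (simp_all add: q_eq z_def)
    show thesis
    proof (rule that[OF h])
      show "l1_norm (h (x i) - h (x j)) \<le> (l2_norm (x i - x j))\<^sup>2" if "i < n" "j < n" for i j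
        using up[OF that] q_le[OF that] by simp
      have "sqrt (\<eta> ^ 3) / 2 / sqrt (real r) * T \<le> (\<Sum>p\<in>?I. q p) / 2"
        using Phi r by (simp add: field_simps)
      also have "\<dots> = (\<Sum>i<n. \<Sum>j<n. q (i, j) / 2)"
        by (simp add: sum.cartesian_product case_prod_beta sum_divide_distrib)
      also have "\<dots> \<le> (\<Sum>i<n. \<Sum>j<n. l1_norm (h (x i) - h (x j)))"
        by (intro sum_mono lo) auto
      finally show "sqrt (\<eta> ^ 3) / 2 / sqrt (real r) * (\<Sum>i<n. \<Sum>j<n. (l2_norm (x i - x j))\<^sup>2)
          \<le> (\<Sum>i<n. \<Sum>j<n. l1_norm (h (x i) - h (x j)))"
        by (simp add: T_eq)
    qed
  qed (use z in auto)
qed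

theorem theorem1p2:
  fixes \<eta> :: real
  assumes "0 < \<eta>" and "\<eta> \<le> 1"
  shows "\<exists>c::real. c > 0 \<and>
    (\<forall>(d::nat) (n::nat) (x :: nat \<Rightarrow> real vec) (r::nat).
       (\<forall>i<n. x i \<in> carrier_vec d) \<longrightarrow> l22_triangle n x \<longrightarrow> has_ssr \<eta> d n x r \<longrightarrow>
       (\<exists>(d'::nat) (h :: real vec \<Rightarrow> real vec).
          h \<in> x ` {..<n} \<rightarrow> carrier_vec d' \<and>
          (\<forall>i<n. \<forall>j<n. l1_norm (h (x i) - h (x j)) \<le> (l2_norm (x i - x j))\<^sup>2) \<and>
          (\<Sum>i<n. \<Sum>j<n. l1_norm (h (x i) - h (x j)))
            \<ge> c / sqrt (real r) * (\<Sum>i<n. \<Sum>j<n. (l2_norm (x i - x j))\<^sup>2)))"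
\<comment> \<open>The factor \<eta>^(3/2) comes from the lower bound on the total of q, the 1/2 from
  Khinchine's inequality.\<close>
proof (intro exI[of _ "sqrt (\<eta> ^ 3) / 2"] conjI allI impI)
  show "0 < sqrt (\<eta> ^ 3) / 2" using assms(1) by simp
  fix d n :: nat and x :: "nat \<Rightarrow> real vec" and r :: nat
  assume x: "\<forall>i<n. x i \<in> carrier_vec d" and tri: "l22_triangle n x" and ssr: "has_ssr \<eta> d n x r"
  let ?T = "\<Sum>i<n. \<Sum>j<n. (l2_norm (x i - x j))\<^sup>2"
  show "\<exists>d' h. h \<in> x ` {..<n} \<rightarrow> carrier_vec d' \<and>
      (\<forall>i<n. \<forall>j<n. l1_norm (h (x i) - h (x j)) \<le> (l2_norm (x i - x j))\<^sup>2) \<and>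
      sqrt (\<eta> ^ 3) / 2 / sqrt (real r) * ?T \<le> (\<Sum>i<n. \<Sum>j<n. l1_norm (h (x i) - h (x j)))"
  proof (cases "0 < ?T \<and> 0 < r")
    case True
    show ?thesis
    proof (rule l22_triangle_l1_embedding[OF assms(1) _ tri ssr])
      show "x i \<in> carrier_vec d" if "i < n" for i using x that by simp
      show "0 < ?T" "0 < r" using True by auto
    qed blast
  next
    case False
    moreover have "0 \<le> ?T" by (simp add: sum_nonneg)
    \<comment> \<open>Either all distances vanish or r = 0, where the quotient by sqrt 0 is 0 by
      convention. The required average is then 0, and a constant map into dimension 0
      suffices.\<close>
    ultimately have zero: "sqrt (\<eta> ^ 3) / 2 / sqrt (real r) * ?T = 0" by auto
    show ?thesis unfolding zero
      by (intro exI[of _ "0::nat"] exI[of _ "\<lambda>_. 0\<^sub>v 0"]) (simp add: l1_norm_def)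
  qed
qed

end
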